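(* Let $h:\mathbb{R}\to\mathbb{R}^+$ be a growth rate, $X$ a Banach space, and $\{U(t,s)\}_{t\ge s}$ an $h$-evolution family on $X$ that is $h$-bounded with constants $K\ge1$ and $\alpha>0$. For $t\ge e_*$ and $u\in C_0(\mathbb{R}_*,X)$ define $$(T_tu)(s):=U(s,s*_h t^{*-1})\,u(s*_h t^{*-1}),\qquad s\in\mathbb{R}_*.$$ Then $\{T_t\}_{t\ge e_*}$ is a strongly continuous $h$-semigroup on $C_0(\mathbb{R}_*,X)$.
   Context: A growth rate is a strictly increasing homeomorphism $h:\mathbb{R}\to\mathbb{R}^+=(0,\infty)$. It induces on $\mathbb{R}$ the abelian group law $t*_h s:=h^{-1}(h(t)h(s))$, with neutral element $e_*:=h^{-1}(1)$ and inverse $t^{*-1}:=h^{-1}(1/h(t))$. $\mathbb{R}_*$ denotes $\mathbb{R}$ with this structure; its order and topology are the usual ones of $\mathbb{R}$. $C_0(\mathbb{R}_*,X)$ is the Banach space of continuous functions $u:\mathbb{R}_*\to X$ vanishing at $\pm\infty$, with norm $\|u\|_{*\infty}=\sup_{s}\|u(s)\|_X$. An $h$-evolution family on $X$ is a collection $\{U(t,s)\}_{t\ge s}$ ($t,s\in\mathbb{R}_*$) of bounded linear operators on $X$ with $U(t,t)=\mathrm{Id}$, $U(t,\tau)U(\tau,s)=U(t,s)$ for $t\ge\tau\ge s$, and $(t,s)\mapsto U(t,s)x$ continuous on $\{t\ge s\}$ for each $x\in X$. It is $h$-bounded with constants $K\ge1$, $\alpha>0$ if $\|U(t,s)\|\le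 K\,[h(t*_h s^{*-1})]^{\alpha}=K\,(h(t)/h(s))^{\alpha}$ for all $t\ge s$. For a Banach space $Y$, a family $\{T_t\}_{t\ge e_*}$ of bounded linear operators $Y\to Y$ is an $h$-semigroup if $T_{e_*}=\mathrm{Id}$ and $T_{t*_h s}=T_tT_s$ for all $t,s\ge e_*$. It is strongly continuous if $\lim_{t\to e_*^+}T_ty=y$ for every $y\in Y$. *)

theory Defs
  imports "HOL-Analysis.Analysis"
begin

subsection \<open>Growth rates and the induced group law\<close>

definition growth_rate :: "(real \<Rightarrow> real) \<Rightarrow> bool" where
  "growth_rate h \<longleftrightarrow> strict_mono h \<and> homeomorphism UNIV {0<..} h (inv h)"

text \<open>
  For a growth rate \<open>h\<close>, \<open>inv h y\<close> is the inverse homeomorphism at every \<open>y > 0\<close>, and these are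
  the only points at which it is evaluated below.
\<close>

definition h_mult :: "(real \<Rightarrow> real) \<Rightarrow> real \<Rightarrow> real \<Rightarrow> real" where
  "h_mult h t s = inv h (h t * h s)"

definition h_unit :: "(real \<Rightarrow> real) \<Rightarrow> real" where
  "h_unit h = inv h 1"

definition h_inv :: "(real \<Rightarrow> real) \<Rightarrow> real \<Rightarrow> real" where
  "h_inv h t = inv h (1 / h t)"


subsection \<open>Evolution families\<close>

text \<open>Only the values \<open>U t s\<close> with \<open>s \<le> t\<close> are constrained.\<close>

definition h_evolution_family :: "(real \<Rightarrow> real \<Rightarrow> ('x::banach \<Rightarrow>\<^sub>L 'x)) \<Rightarrow> bool" where
  "h_evolution_family U \<longleftrightarrow>
     (\<forall>t. U t t = id_blinfun) \<and>
     (\<forall>t r s. s \<le> r \<longrightarrow> r \<le> t \<longrightarrow> U t r o\<^sub>L U r s = U t s) \<and>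
     (\<forall>x. continuous_on {(t, s). s \<le> t} (\<lambda>(t, s). blinfun_apply (U t s) x))"

definition h_bounded ::
  "(real \<Rightarrow> real) \<Rightarrow> (real \<Rightarrow> real \<Rightarrow> ('x::banach \<Rightarrow>\<^sub>L 'x)) \<Rightarrow> real \<Rightarrow> real \<Rightarrow> bool" where
  "h_bounded h U K \<alpha> \<longleftrightarrow>
     1 \<le> K \<and> 0 < \<alpha> \<and>
     (\<forall>t s. s \<le> t \<longrightarrow> norm (U t s) \<le> K * (h (h_mult h t (h_inv h s))) powr \<alpha>)"


subsection \<open>Semigroups with respect to the induced group law\<close>

text \<open>Only the operators \<open>T t\<close> with \<open>t \<ge> h_unit h\<close> are constrained.\<close>

definition h_semigroup :: "(real \<Rightarrow> real) \<Rightarrow> (real \<Rightarrow> 'y::banach \<Rightarrow> 'y) \<Rightarrow> bool" where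
  "h_semigroup h T \<longleftrightarrow>
     (\<forall>t\<ge>h_unit h. bounded_linear (T t)) \<and>
     T (h_unit h) = id \<and>
     (\<forall>t\<ge>h_unit h. \<forall>s\<ge>h_unit h. T (h_mult h t s) = T t \<circ> T s)"

definition h_strongly_continuous :: "(real \<Rightarrow> real) \<Rightarrow> (real \<Rightarrow> 'y::banach \<Rightarrow> 'y) \<Rightarrow> bool" where
  "h_strongly_continuous h T \<longleftrightarrow> (\<forall>y. ((\<lambda>t. T t y) \<longlongrightarrow> y) (at_right (h_unit h)))"


subsection \<open>The Banach space of continuous functions on the line vanishing at infinity\<close>

definition C0 :: "(real \<Rightarrow> 'b::real_normed_vector) set" where
  "C0 = {u. continuous_on UNIV u \<and> (u \<longlongrightarrow> 0) at_top \<and> (u \<longlongrightarrow> 0) at_bot}"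

typedef (overloaded) 'b c0fun = "C0 :: (real \<Rightarrow> 'b::real_normed_vector) set"
  morphisms apply_c0fun C0fun
  by (rule exI[of _ "\<lambda>_. 0"]) (simp add: C0_def)

setup_lifting type_definition_c0fun

lemma C0_bounded:
  fixes u :: "real \<Rightarrow> 'b::real_normed_vector"
  assumes "u \<in> C0"
  shows "bounded (range u)"
proof -
  have c: "continuous_on UNIV u" and t: "(u \<longlongrightarrow> 0) at_top" and b: "(u \<longlongrightarrow> 0) at_bot"
    using assms by (auto simp: C0_def)
  from tendstoD[OF t, of 1] obtain M where M: "\<And>x. x \<ge> M \<Longrightarrow> norm (u x) < 1"
    by (auto simp: eventually_at_top_linorder)
  from tendstoD[OF b, of 1] obtain N where N: "\<And>x. x \<le> N \<Longrightarrow> norm (u x) < 1"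
    by (auto simp: eventually_at_bot_linorder)
  have "bounded (u ` {N..M})"
    by (intro compact_imp_bounded compact_continuous_image continuous_on_subset[OF c]) auto
  then obtain B where B: "\<forall>x\<in>{N..M}. norm (u x) \<le> B"
    unfolding bounded_iff by fast
  have "norm (u x) \<le> max B 1" for x
    using M[of x] N[of x] bspec[OF B, of x] by (cases "x \<ge> M"; cases "x \<le> N") auto
  then show ?thesis
    by (auto simp: bounded_iff)
qed

lemma C0_imp_bcontfun: "u \<in> C0 \<Longrightarrow> u \<in> bcontfun"
  using C0_bounded by (auto simp: C0_def bcontfun_def)

definition bcontfun_of_c0fun :: "'b::real_normed_vector c0fun \<Rightarrow> (real \<Rightarrow>\<^sub>C 'b)"
  where "bcontfun_of_c0fun u = Bcontfun (apply_c0fun u)"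

lemma c0fun_eqI: "(\<And>s. apply_c0fun u s = apply_c0fun v s) \<Longrightarrow> u = v"
  by transfer auto

lemma apply_bcontfun_of_c0fun [simp]:
  "apply_bcontfun (bcontfun_of_c0fun u) = apply_c0fun u"
  by (simp add: bcontfun_of_c0fun_def Bcontfun_inverse C0_imp_bcontfun apply_c0fun)

instantiation c0fun :: (real_normed_vector) real_vector
begin

lift_definition zero_c0fun :: "'a c0fun" is "\<lambda>_. 0"
  by (simp add: C0_def)

lift_definition plus_c0fun :: "'a c0fun \<Rightarrow> 'a c0fun \<Rightarrow> 'a c0fun" is "\<lambda>u v s. u s + v s"
  unfolding C0_def by (simp add: continuous_on_add tendsto_add_zero)

lift_definition minus_c0fun :: "'a c0fun \<Rightarrow> 'a c0fun \<Rightarrow> 'a c0fun" is "\<lambda>u v s. u s - v s"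
  unfolding C0_def using tendsto_diff[where a = 0 and b = 0]
  by (fastforce simp: continuous_on_diff)

lift_definition uminus_c0fun :: "'a c0fun \<Rightarrow> 'a c0fun" is "\<lambda>u s. - u s"
  unfolding C0_def using tendsto_minus[where a = 0]
  by (fastforce simp: continuous_on_minus)

lift_definition scaleR_c0fun :: "real \<Rightarrow> 'a c0fun \<Rightarrow> 'a c0fun" is "\<lambda>c u s. c *\<^sub>R u s"
  unfolding C0_def using tendsto_scaleR[OF tendsto_const, where b = 0]
  by (fastforce simp: continuous_on_scaleR)

instance
  by standard (transfer; simp add: fun_eq_iff algebra_simps)+

end

instantiation c0fun :: (real_normed_vector) real_normed_vector
begin

lift_definition norm_c0fun :: "'a c0fun \<Rightarrow> real" is "\<lambda>u. SUP s. norm (u s)" .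

definition dist_c0fun :: "'a c0fun \<Rightarrow> 'a c0fun \<Rightarrow> real"
  where "dist_c0fun u v = norm (u - v)"

definition sgn_c0fun :: "'a c0fun \<Rightarrow> 'a c0fun"
  where "sgn_c0fun u = u /\<^sub>R norm u"

definition uniformity_c0fun :: "('a c0fun \<times> 'a c0fun) filter"
  where "uniformity_c0fun = (INF e\<in>{0<..}. principal {(u, v). dist u v < e})"

definition open_c0fun :: "'a c0fun set \<Rightarrow> bool"
  where "open_c0fun S = (\<forall>u\<in>S. \<forall>\<^sub>F (u', v) in uniformity. u' = u \<longrightarrow> v \<in> S)"

lemma norm_bcontfun_of_c0fun: "norm (bcontfun_of_c0fun (u :: 'a c0fun)) = norm u"
  unfolding norm_bcontfun_def dist_bcontfun.rep_eq norm_c0fun.rep_eq by (simp add: dist_norm)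

lemma bcontfun_of_c0fun_add:
  "bcontfun_of_c0fun (u + v :: 'a c0fun) = bcontfun_of_c0fun u + bcontfun_of_c0fun v"
  by (rule bcontfun_eqI) (simp add: plus_c0fun.rep_eq)

lemma bcontfun_of_c0fun_diff:
  "bcontfun_of_c0fun (u - v :: 'a c0fun) = bcontfun_of_c0fun u - bcontfun_of_c0fun v"
  by (rule bcontfun_eqI) (simp add: minus_c0fun.rep_eq)

lemma bcontfun_of_c0fun_scaleR:
  "bcontfun_of_c0fun (c *\<^sub>R u :: 'a c0fun) = c *\<^sub>R bcontfun_of_c0fun u"
  by (rule bcontfun_eqI) (simp add: scaleR_c0fun.rep_eq)

lemma bcontfun_of_c0fun_eq_0: "bcontfun_of_c0fun (u :: 'a c0fun) = 0 \<longleftrightarrow> u = 0"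
proof
  assume "bcontfun_of_c0fun u = 0"
  then have "apply_c0fun u s = 0" for s
    by (metis apply_bcontfun_of_c0fun zero_bcontfun.rep_eq)
  then show "u = 0"
    by (intro c0fun_eqI) (simp add: zero_c0fun.rep_eq)
next
  assume "u = 0"
  then show "bcontfun_of_c0fun u = 0"
    by (intro bcontfun_eqI) (simp add: zero_c0fun.rep_eq)
qed

instance
proof
  fix u v :: "'a c0fun" and c :: real
  show "norm u = 0 \<longleftrightarrow> u = 0"
    by (simp flip: norm_bcontfun_of_c0fun bcontfun_of_c0fun_eq_0)
  show "norm (u + v) \<le> norm u + norm v"
    by (simp flip: norm_bcontfun_of_c0fun add: bcontfun_of_c0fun_add norm_triangle_ineq)
  show "norm (c *\<^sub>R u) = \<bar>c\<bar> * norm u"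
    by (simp flip: norm_bcontfun_of_c0fun add: bcontfun_of_c0fun_scaleR)
qed (rule dist_c0fun_def sgn_c0fun_def uniformity_c0fun_def open_c0fun_def)+

end

lemma dist_bcontfun_of_c0fun: "dist (bcontfun_of_c0fun u) (bcontfun_of_c0fun v) = dist u v"
  by (simp add: dist_norm norm_bcontfun_of_c0fun flip: bcontfun_of_c0fun_diff)

instance c0fun :: (banach) banach
proof
  fix X :: "nat \<Rightarrow> 'a c0fun"
  assume "Cauchy X"
  then have "Cauchy (\<lambda>n. bcontfun_of_c0fun (X n))"
    by (simp add: Cauchy_def dist_bcontfun_of_c0fun)
  then obtain f where f: "(\<lambda>n. bcontfun_of_c0fun (X n)) \<longlonglongrightarrow> f"
    using Cauchy_convergent convergent_def by blast
  then have ul: "uniform_limit UNIV (\<lambda>n. apply_c0fun (X n)) (apply_bcontfun f) sequentially"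
    using tendsto_bcontfun_uniform_limit by fastforce
  have X: "(apply_c0fun (X n) \<longlongrightarrow> 0) at_top" "(apply_c0fun (X n) \<longlongrightarrow> 0) at_bot" for n
    using apply_c0fun[of "X n"] by (auto simp: C0_def)
  have lim: "(apply_bcontfun f \<longlongrightarrow> 0) F" if F: "\<And>n. (apply_c0fun (X n) \<longlongrightarrow> 0) F" for F
  proof (rule tendstoI)
    fix e :: real
    assume "e > 0"
    then have "\<forall>\<^sub>F n in sequentially. \<forall>s\<in>UNIV. dist (apply_c0fun (X n) s) (apply_bcontfun f s) < e / 2"
      using ul by (intro uniform_limitD) auto
    then obtain n where n: "\<And>s. dist (apply_c0fun (X n) s) (apply_bcontfun f s) < e / 2"
      by (auto simp: eventually_sequentially)
    have "\<forall>\<^sub>F s in F. dist (apply_c0fun (X n) s) 0 < e / 2"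
      using F[of n] \<open>e > 0\<close> by (intro tendstoD) auto
    then show "\<forall>\<^sub>F s in F. dist (apply_bcontfun f s) 0 < e"
    proof eventually_elim
      case (elim s)
      then show ?case
        using n[of s] dist_triangle_half_r by blast
    qed
  qed
  have "apply_bcontfun f \<in> C0"
    using lim X by (auto simp: C0_def)
  then have "bcontfun_of_c0fun (C0fun (apply_bcontfun f)) = f"
    by (intro bcontfun_eqI) (simp add: C0fun_inverse)
  with f have "(\<lambda>n. bcontfun_of_c0fun (X n)) \<longlonglongrightarrow> bcontfun_of_c0fun (C0fun (apply_bcontfun f))"
    by metis
  then have "X \<longlonglongrightarrow> C0fun (apply_bcontfun f)"
    unfolding tendsto_iff dist_bcontfun_of_c0fun .
  then show "convergent X"
    by (auto simp: convergent_def)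
qed


subsection \<open>The evolution semigroup\<close>

definition evolution_fun ::
  "(real \<Rightarrow> real) \<Rightarrow> (real \<Rightarrow> real \<Rightarrow> ('x::banach \<Rightarrow>\<^sub>L 'x)) \<Rightarrow> real \<Rightarrow> (real \<Rightarrow> 'x) \<Rightarrow> real \<Rightarrow> 'x" where
  "evolution_fun h U t u =
     (\<lambda>s. blinfun_apply (U s (h_mult h s (h_inv h t))) (u (h_mult h s (h_inv h t))))"

text \<open>
  \<open>C0fun\<close> is unspecified outside \<open>C0\<close>, so this definition says what it should only
  where \<open>evolution_fun h U t\<close> maps \<open>C0\<close> into \<open>C0\<close>.
\<close>

definition evolution_op ::
  "(real \<Rightarrow> real) \<Rightarrow> (real \<Rightarrow> real \<Rightarrow> ('x::banach \<Rightarrow>\<^sub>L 'x)) \<Rightarrow> real \<Rightarrow> 'x c0fun \<Rightarrow> 'x c0fun" where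
  "evolution_op h U t u = C0fun (evolution_fun h U t (apply_c0fun u))"

end

theory Submission
  imports Defs
begin

text \<open>
  Since \<open>h (s *\<^sub>h t\<^sup>*\<^sup>-\<^sup>1) = h s / h t\<close>, the bound on \<open>U\<close> gives
  \<open>\<parallel>U(s, s *\<^sub>h t\<^sup>*\<^sup>-\<^sup>1)\<parallel> \<le> K h(t)\<^sup>\<alpha>\<close> uniformly in \<open>s\<close>. Together with the strong continuity of \<open>U\<close>
  it makes \<open>(s, t) \<mapsto> (T\<^sub>t u)(s)\<close> jointly continuous and small for large \<open>\<bar>s\<bar>\<close>, uniformly for \<open>t\<close> near
  \<open>e\<^sub>*\<close>. On the remaining compact range of \<open>s\<close>, uniform continuity gives \<open>T\<^sub>t u \<longlonglongrightarrow> u\<close>.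
\<close>

section \<open>Order, algebra and continuity of the induced group law\<close>

abbreviation h_shift :: "(real \<Rightarrow> real) \<Rightarrow> real \<Rightarrow> real \<Rightarrow> real" where
  "h_shift h t s \<equiv> h_mult h s (h_inv h t)"

context
  fixes h :: "real \<Rightarrow> real"
  assumes h: "growth_rate h"
begin

lemma growth_rate_pos: "0 < h x"
  using h by (auto simp: growth_rate_def homeomorphism_def)

lemma inv_growth_rate: "0 < y \<Longrightarrow> h (inv h y) = y"
  using h by (auto simp: growth_rate_def homeomorphism_def)

lemma growth_rate_inv: "inv h (h x) = x"
  using h by (auto simp: growth_rate_def homeomorphism_def)

lemma growth_rate_less_eq: "h x \<le> h y \<longleftrightarrow> x \<le> y"
  using h by (simp add: growth_rate_def strict_mono_less_eq)

lemma growth_rate_eq: "h x = h y \<longleftrightarrow> x = y"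
  using h by (simp add: growth_rate_def strict_mono_eq)

lemma growth_rate_h_unit: "h (h_unit h) = 1"
  by (simp add: h_unit_def inv_growth_rate)

lemma growth_rate_h_mult: "h (h_mult h t s) = h t * h s"
  by (simp add: h_mult_def inv_growth_rate growth_rate_pos)

lemma growth_rate_h_inv: "h (h_inv h t) = 1 / h t"
  by (simp add: h_inv_def inv_growth_rate growth_rate_pos)

text \<open>The map \<open>h\<close> is an order isomorphism onto the multiplicative positive reals,
  so applying it to both sides reduces claims about the group law to arithmetic of products and
  quotients.\<close>

lemmas growth_rate_simps = growth_rate_inv growth_rate_less_eq growth_rate_eq
  growth_rate_h_unit growth_rate_h_mult growth_rate_h_inv

lemma h_shift_h_unit: "h_shift h (h_unit h) s = s"
  by (subst growth_rate_eq[symmetric]) (simp add: growth_rate_simps)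

lemma h_shift_h_mult: "h_shift h (h_mult h t s) r = h_shift h s (h_shift h t r)"
  by (subst growth_rate_eq[symmetric]) (simp add: growth_rate_simps)

lemma h_unit_le_iff: "h_unit h \<le> t \<longleftrightarrow> 1 \<le> h t"
  by (subst growth_rate_less_eq[symmetric]) (simp add: growth_rate_simps)

lemma h_unit_le_h_mult: "h_unit h \<le> t \<Longrightarrow> h_unit h \<le> s \<Longrightarrow> h_unit h \<le> h_mult h t s"
  using mult_mono[of 1 "h t" 1 "h s"] by (simp add: h_unit_le_iff growth_rate_simps)

text \<open>The shift is translation by the inverse of \<open>t\<close>, and translations preserve
  order. Preimages of rays are therefore rays with explicit endpoints, which gives the limits at
  infinity and later the cutoff on the right.\<close>

lemma le_h_shift_iff: "N \<le> h_shift h t s \<longleftrightarrow> h_mult h N t \<le> s"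
  unfolding growth_rate_less_eq[symmetric, of N] growth_rate_less_eq[symmetric, of _ s]
  by (simp add: growth_rate_simps growth_rate_pos pos_le_divide_eq)

lemma h_shift_le_iff: "h_shift h t s \<le> N \<longleftrightarrow> s \<le> h_mult h N t"
  unfolding growth_rate_less_eq[symmetric, of _ N] growth_rate_less_eq[symmetric, of s]
  by (simp add: growth_rate_simps growth_rate_pos pos_divide_le_eq)

lemma h_shift_le: "h_unit h \<le> t \<Longrightarrow> h_shift h t s \<le> s"
  unfolding growth_rate_less_eq[symmetric, of _ s]
  using growth_rate_pos[of s] by (simp add: h_unit_le_iff growth_rate_simps growth_rate_pos pos_divide_le_eq)

lemma h_shift_antimono: "t \<le> t' \<Longrightarrow> h_shift h t' s \<le> h_shift h t s"
  unfolding growth_rate_less_eq[symmetric, of "h_shift h t' s"]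
  by (simp add: growth_rate_simps growth_rate_pos divide_left_mono order.strict_implies_order)

lemma continuous_on_growth_rate: "continuous_on A h"
  using h continuous_on_subset[of UNIV h A] by (auto simp: growth_rate_def homeomorphism_def)

lemma continuous_on_h_shift: "continuous_on A (\<lambda>(s, t). h_shift h t s)"
proof -
  have "continuous_on {0<..} (inv h)"
    using h by (auto simp: growth_rate_def homeomorphism_def)
  moreover have "continuous_on A (\<lambda>p. h (fst p) / h (snd p))"
    using growth_rate_pos
    by (intro continuous_on_divide continuous_on_compose2[OF continuous_on_growth_rate[of UNIV]]
          continuous_intros) (auto simp: less_imp_neq[THEN not_sym])
  ultimately have "continuous_on A (\<lambda>p. inv h (h (fst p) / h (snd p)))"
    by (rule continuous_on_compose2) (auto simp: growth_rate_pos)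
  then show ?thesis
    by (simp add: h_mult_def growth_rate_h_inv case_prod_unfold)
qed

lemma filterlim_h_shift_at_top: "filterlim (h_shift h t) at_top at_top"
  unfolding filterlim_at_top le_h_shift_iff by (auto intro: eventually_ge_at_top)

lemma filterlim_h_shift_at_bot: "filterlim (h_shift h t) at_bot at_bot"
  unfolding filterlim_at_bot h_shift_le_iff by (auto intro: eventually_le_at_bot)

end

text \<open>Strong continuity of \<open>U\<close> concerns a fixed vector, whereas in
  \<open>evolution_fun\<close> the vector moves with the operator. A local norm bound makes up the
  difference: \<open>A i (v i - x)\<close> tends to 0.\<close>

lemma tendsto_blinfun_apply_bounded:
  fixes A :: "'i \<Rightarrow> ('a::real_normed_vector \<Rightarrow>\<^sub>L 'b::real_normed_vector)"
  assumes A: "((\<lambda>i. A i x) \<longlongrightarrow> L) F" and v: "(v \<longlongrightarrow> x) F" and B: "\<forall>\<^sub>F i in F. norm (A i) \<le> B"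
  shows "((\<lambda>i. A i (v i)) \<longlongrightarrow> L) F"
proof -
  have "((\<lambda>i. A i (v i - x)) \<longlongrightarrow> 0) F"
  proof (rule Lim_null_comparison)
    show "\<forall>\<^sub>F i in F. norm (A i (v i - x)) \<le> B * norm (v i - x)"
      using B by eventually_elim (meson mult_right_mono norm_blinfun norm_ge_zero order_trans)
    show "((\<lambda>i. B * norm (v i - x)) \<longlongrightarrow> 0) F"
      using tendsto_mult_right_zero[OF tendsto_norm_zero[OF LIM_zero[OF v]]] .
  qed
  from tendsto_add[OF this A] show ?thesis
    by (simp add: blinfun.diff_right)
qed

lemma norm_apply_c0fun: "norm (apply_c0fun u s) \<le> norm u"
  using norm_bounded[of "bcontfun_of_c0fun u" s] by (simp add: norm_bcontfun_of_c0fun)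

lemma norm_c0fun_le: "(\<And>s. norm (apply_c0fun u s) \<le> b) \<Longrightarrow> norm u \<le> b"
  unfolding norm_bcontfun_of_c0fun[symmetric] by (rule norm_bound) simp

section \<open>Bounds and joint continuity of \<open>evolution_fun\<close>\<close>

context
  fixes h :: "real \<Rightarrow> real"
    and U :: "real \<Rightarrow> real \<Rightarrow> ('x::banach \<Rightarrow>\<^sub>L 'x)"
    and K \<alpha> :: real
  assumes h: "growth_rate h"
    and U: "h_evolution_family U"
    and b: "h_bounded h U K \<alpha>"
begin

text \<open>The quotient of \<open>h s\<close> by \<open>h s / h t\<close> is \<open>h t\<close>, so
  \<open>s\<close> cancels from the growth bound.\<close>

lemma norm_h_shift_le:
  assumes "h_unit h \<le> t"
  shows "norm (U s (h_shift h t s)) \<le> K * h t powr \<alpha>"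
proof -
  have "norm (U s (h_shift h t s)) \<le> K * h (h_mult h s (h_inv h (h_shift h t s))) powr \<alpha>"
    using b h_shift_le[OF h assms] by (auto simp: h_bounded_def)
  also have "h (h_mult h s (h_inv h (h_shift h t s))) = h t"
    using growth_rate_pos[OF h, of s] by (simp add: growth_rate_simps[OF h])
  finally show ?thesis .
qed

lemma bound_nonneg: "0 \<le> K * h t powr \<alpha>"
  using b by (simp add: h_bounded_def)

lemma norm_evolution_fun_le:
  assumes "h_unit h \<le> t"
  shows "norm (evolution_fun h U t u s) \<le> K * h t powr \<alpha> * norm (u (h_shift h t s))"
  unfolding evolution_fun_def
  using norm_blinfun norm_h_shift_le[OF assms] by (meson mult_right_mono norm_ge_zero order_trans)

lemma bound_mono:
  assumes "t \<le> t'"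
  shows "K * h t powr \<alpha> \<le> K * h t' powr \<alpha>"
  using b assms by (intro mult_left_mono powr_mono2)
    (auto simp: h_bounded_def growth_rate_simps[OF h] growth_rate_pos[OF h] less_imp_le)

text \<open>Capping \<open>t\<close> at \<open>T\<close> keeps the operator norms uniformly bounded.
  Fixed \<open>t\<close> serves membership in \<open>C0\<close>, and varying \<open>t\<close> serves
  strong continuity.\<close>

lemma continuous_on_evolution_fun:
  assumes u: "continuous_on UNIV u"
  shows "continuous_on (UNIV \<times> {h_unit h..T}) (\<lambda>(s, t). evolution_fun h U t u s)"
  unfolding continuous_on_def
proof
  let ?D = "(UNIV :: real set) \<times> {h_unit h..T}"
  fix p assume p: "p \<in> ?D"
  let ?\<phi> = "\<lambda>q. h_shift h (snd q) (fst q)"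
  have \<phi>: "continuous_on ?D ?\<phi>"
    using continuous_on_h_shift[OF h] by (simp add: case_prod_unfold)
  \<comment> \<open>The vector is frozen at its value at the limit point \<open>p\<close>; its
    motion is handled separately below.\<close>
  have "continuous_on {(t, s). s \<le> t} (\<lambda>(t, s). U t s (u (?\<phi> p)))"
    using U by (simp add: h_evolution_family_def)
  then have "continuous_on ?D (\<lambda>q. case (fst q, ?\<phi> q) of (t, s) \<Rightarrow> U t s (u (?\<phi> p)))"
    by (rule continuous_on_compose2) (auto intro!: continuous_intros \<phi> h_shift_le[OF h])
  then have "((\<lambda>q. U (fst q) (?\<phi> q) (u (?\<phi> p))) \<longlongrightarrow> U (fst p) (?\<phi> p) (u (?\<phi> p))) (at p within ?D)"
    using p by (cases p) (simp add: continuous_on_def)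
  moreover have "((\<lambda>q. u (?\<phi> q)) \<longlongrightarrow> u (?\<phi> p)) (at p within ?D)"
    using continuous_on_compose2[OF u \<phi>] p by (cases p) (simp add: continuous_on_def)
  moreover have "\<forall>\<^sub>F q in at p within ?D. norm (U (fst q) (?\<phi> q)) \<le> K * h T powr \<alpha>"
    unfolding eventually_at_filter
    by (intro always_eventually allI impI order_trans[OF norm_h_shift_le bound_mono]) auto
  ultimately have "((\<lambda>q. U (fst q) (?\<phi> q) (u (?\<phi> q))) \<longlongrightarrow> U (fst p) (?\<phi> p) (u (?\<phi> p))) (at p within ?D)"
    by (rule tendsto_blinfun_apply_bounded)
  then show "((\<lambda>(s, t). evolution_fun h U t u s) \<longlongrightarrow> (case p of (s, t) \<Rightarrow> evolution_fun h U t u s)) (at p within ?D)"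
    by (simp add: evolution_fun_def case_prod_unfold)
qed

lemma evolution_fun_in_C0:
  assumes t: "h_unit h \<le> t" and u: "u \<in> C0"
  shows "evolution_fun h U t u \<in> C0"
proof -
  \<comment> \<open>The slice at height \<open>t\<close> of the strip with cap
    \<open>T = t\<close>.\<close>
  have "continuous_on UNIV (\<lambda>s. case (s, t) of (s, t) \<Rightarrow> evolution_fun h U t u s)"
    using u t by (intro continuous_on_compose2[OF continuous_on_evolution_fun[of u t]] continuous_intros)
      (auto simp: C0_def)
  \<comment> \<open>A general filter \<open>F\<close> covers \<open>at_top\<close> and
    \<open>at_bot\<close> at once.\<close>
  moreover have "(evolution_fun h U t u \<longlongrightarrow> 0) F"
    if "(u \<longlongrightarrow> 0) F" "filterlim (h_shift h t) F F" for F
  proof (rule Lim_null_comparison)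
    show "\<forall>\<^sub>F s in F. norm (evolution_fun h U t u s) \<le> K * h t powr \<alpha> * norm (u (h_shift h t s))"
      using norm_evolution_fun_le[OF t] by simp
    show "((\<lambda>s. K * h t powr \<alpha> * norm (u (h_shift h t s))) \<longlongrightarrow> 0) F"
      by (intro tendsto_mult_right_zero tendsto_norm_zero filterlim_compose[OF that])
  qed
  ultimately show ?thesis
    using u filterlim_h_shift_at_top[OF h] filterlim_h_shift_at_bot[OF h] by (simp add: C0_def)
qed

section \<open>The semigroup of bounded operators on \<open>c0fun\<close>\<close>

lemma apply_evolution_op:
  "h_unit h \<le> t \<Longrightarrow> apply_c0fun (evolution_op h U t u) = evolution_fun h U t (apply_c0fun u)"
  unfolding evolution_op_def by (intro C0fun_inverse evolution_fun_in_C0 apply_c0fun)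

lemma bounded_linear_evolution_op:
  assumes t: "h_unit h \<le> t"
  shows "bounded_linear (evolution_op h U t)"
proof (rule bounded_linear_intro)
  fix u v :: "'x c0fun" and c :: real
  show "evolution_op h U t (u + v) = evolution_op h U t u + evolution_op h U t v"
    by (rule c0fun_eqI)
      (simp add: apply_evolution_op[OF t] plus_c0fun.rep_eq evolution_fun_def blinfun.add_right)
  show "evolution_op h U t (c *\<^sub>R u) = c *\<^sub>R evolution_op h U t u"
    by (rule c0fun_eqI)
      (simp add: apply_evolution_op[OF t] scaleR_c0fun.rep_eq evolution_fun_def blinfun.scaleR_right)
  show "norm (evolution_op h U t u) \<le> norm u * (K * h t powr \<alpha>)"
  proof (rule norm_c0fun_le)
    fix s
    have "norm (evolution_fun h U t (apply_c0fun u) s) \<le>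
        K * h t powr \<alpha> * norm (apply_c0fun u (h_shift h t s))"
      by (rule norm_evolution_fun_le[OF t])
    also have "\<dots> \<le> K * h t powr \<alpha> * norm u"
      by (intro mult_left_mono norm_apply_c0fun bound_nonneg)
    finally show "norm (apply_c0fun (evolution_op h U t u) s) \<le> norm u * (K * h t powr \<alpha>)"
      by (simp add: apply_evolution_op[OF t] mult.commute)
  qed
qed

lemma evolution_fun_h_unit: "evolution_fun h U (h_unit h) u = u"
  using U by (simp add: evolution_fun_def h_shift_h_unit[OF h] h_evolution_family_def)

text \<open>Shifting by a product is shifting twice, so this is the composition law of
  \<open>U\<close> with intermediate time \<open>h_shift h t r\<close>.\<close>

lemma evolution_fun_h_mult:
  assumes t: "h_unit h \<le> t" and s: "h_unit h \<le> s"
  shows "evolution_fun h U (h_mult h t s) u = evolution_fun h U t (evolution_fun h U s u)"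
proof
  fix r
  have "U r (h_shift h t r) o\<^sub>L U (h_shift h t r) (h_shift h s (h_shift h t r))
      = U r (h_shift h s (h_shift h t r))"
    using U h_shift_le[OF h s] h_shift_le[OF h t] by (auto simp: h_evolution_family_def)
  then show "evolution_fun h U (h_mult h t s) u r = evolution_fun h U t (evolution_fun h U s u) r"
    unfolding evolution_fun_def h_shift_h_mult[OF h] by (metis blinfun_apply_blinfun_compose)
qed

lemma h_semigroup_evolution_op: "h_semigroup h (evolution_op h U)"
  unfolding h_semigroup_def
proof (intro conjI allI impI ext)
  show "bounded_linear (evolution_op h U t)" if "h_unit h \<le> t" for t
    using bounded_linear_evolution_op[OF that] .
  show "evolution_op h U (h_unit h) u = id u" for u
    by (simp add: evolution_op_def evolution_fun_h_unit apply_c0fun_inverse)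
  show "evolution_op h U (h_mult h t s) u = (evolution_op h U t \<circ> evolution_op h U s) u"
    if "h_unit h \<le> t" "h_unit h \<le> s" for t s u
    using that by (intro c0fun_eqI)
      (simp add: apply_evolution_op h_unit_le_h_mult[OF h] evolution_fun_h_mult)
qed

section \<open>Uniform smallness at infinity and strong continuity\<close>

lemma evolution_fun_small_at_infinity:
  assumes u: "u \<in> C0" and e: "0 < e"
  obtains m M where "\<And>s t. h_unit h \<le> t \<Longrightarrow> t \<le> T \<Longrightarrow> s \<notin> {m..M} \<Longrightarrow>
    norm (evolution_fun h U t u s) < e"
proof -
  \<comment> \<open>Dominates the operator norms for all \<open>t\<close> up to \<open>T\<close>;
    the added 1 makes it strictly positive, so \<open>e / C\<close> is a valid threshold.\<close>
  define C where "C = K * h T powr \<alpha> + 1"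
  have C: "0 < C"
    using bound_nonneg[of T] by (simp add: C_def)
  have "\<forall>\<^sub>F x in at_top. norm (u x) < e / C" "\<forall>\<^sub>F x in at_bot. norm (u x) < e / C"
    using u e C tendstoD[of u 0 _ "e / C"] by (simp_all add: C0_def)
  then obtain N m where N: "\<And>x. N \<le> x \<Longrightarrow> norm (u x) < e / C"
    and m: "\<And>x. x \<le> m \<Longrightarrow> norm (u x) < e / C"
    by (auto simp: eventually_at_top_linorder eventually_at_bot_linorder)
  show ?thesis
  proof
    \<comment> \<open>Shifts move points to the left, so \<open>m\<close> works for every
      \<open>t\<close>. On the right the largest displacement occurs at \<open>T\<close>, whence the
      endpoint \<open>h_mult h N T\<close>.\<close>
    fix s t assume t: "h_unit h \<le> t" "t \<le> T" and s: "s \<notin> {m..h_mult h N T}"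
    have "h_shift h t s \<le> m" if "s < m"
      using h_shift_le[OF h t(1), of s] that by simp
    moreover have "N \<le> h_shift h t s" if "h_mult h N T < s"
      using le_h_shift_iff[OF h, of N s T] h_shift_antimono[OF h t(2), of s] that by simp
    ultimately have small: "norm (u (h_shift h t s)) < e / C"
      using s N m by fastforce
    have "norm (evolution_fun h U t u s) \<le> K * h t powr \<alpha> * norm (u (h_shift h t s))"
      by (rule norm_evolution_fun_le[OF t(1)])
    also have "\<dots> \<le> C * norm (u (h_shift h t s))"
      using bound_mono[OF t(2)] by (intro mult_right_mono) (simp_all add: C_def)
    also have "\<dots> < e"
      using small C by (simp add: pos_less_divide_eq mult.commute)
    finally show "norm (evolution_fun h U t u s) < e" .
  qed
qed

lemma h_strongly_continuous_evolution_op: "h_strongly_continuous h (evolution_op h U)"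
  unfolding h_strongly_continuous_def
proof (intro allI tendstoI)
  fix y :: "'x c0fun" and e :: real assume "0 < e"
  \<comment> \<open>Any cap above \<open>h_unit h\<close> would do, since the limit is
    local.\<close>
  define T where "T = h_unit h + 1"
  define G where "G = (\<lambda>(s, t). evolution_fun h U t (apply_c0fun y) s)"
  have y: "apply_c0fun y \<in> C0"
    by (rule apply_c0fun)
  have G0: "G (s, h_unit h) = apply_c0fun y s" for s
    by (simp add: G_def evolution_fun_h_unit)
  \<comment> \<open>Two tails below \<open>e / 4\<close> differ by less than \<open>e / 2\<close>,
    matching the estimate on the compact part. The supremum keeps only a weak inequality, so the
    bound \<open>e / 2\<close> leaves room for the strict one.\<close>
  obtain m M where mM: "\<And>s t. h_unit h \<le> t \<Longrightarrow> t \<le> T \<Longrightarrow> s \<notin> {m..M} \<Longrightarrow> norm (G (s, t)) < e / 4"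
    using evolution_fun_small_at_infinity[OF y, of "e / 4" T] \<open>0 < e\<close> unfolding G_def by auto
  have "uniformly_continuous_on ({m..M} \<times> {h_unit h..T}) G"
    using y continuous_on_evolution_fun[of "apply_c0fun y" T] unfolding G_def
    by (intro compact_uniformly_continuous compact_Times compact_Icc)
      (auto simp: C0_def elim: continuous_on_subset)
  from uniformly_continuous_onE[OF this, of "e / 2"] \<open>0 < e\<close>
  obtain d where d: "0 < d" and dG: "\<And>p q. p \<in> {m..M} \<times> {h_unit h..T} \<Longrightarrow>
      q \<in> {m..M} \<times> {h_unit h..T} \<Longrightarrow> dist q p < d \<Longrightarrow> dist (G q) (G p) < e / 2"
    by (metis half_gt_zero)
  \<comment> \<open>Here \<open>d\<close> controls uniform continuity between \<open>(s, t)\<close>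
    and \<open>(s, h_unit h)\<close>, and 1 keeps \<open>t\<close> below \<open>T\<close>.\<close>
  have close: "dist (evolution_op h U t y) y < e" if "h_unit h < t" "t < h_unit h + min d 1" for t
  proof -
    have t: "h_unit h \<le> t" "t \<le> T" "dist t (h_unit h) < d" and T: "h_unit h \<le> T"
      using that by (auto simp: T_def dist_real_def)
    have "norm (G (s, t) - G (s, h_unit h)) \<le> e / 2" for s
    proof (cases "s \<in> {m..M}")
      case True
      then have "dist (G (s, t)) (G (s, h_unit h)) < e / 2"
        using t T by (intro dG) (auto simp: dist_Pair_Pair)
      then show ?thesis
        by (simp add: dist_norm)
    next
      case False
      then show ?thesis
        using mM[OF t(1,2), of s] mM[OF order_refl T, of s]
          norm_triangle_ineq4[of "G (s, t)" "G (s, h_unit h)"] by linarith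
    qed
    then have "norm (evolution_op h U t y - y) \<le> e / 2"
      by (intro norm_c0fun_le) (simp add: minus_c0fun.rep_eq apply_evolution_op t G0, simp add: G_def)
    then show ?thesis
      using \<open>0 < e\<close> by (simp add: dist_norm)
  qed
  show "\<forall>\<^sub>F t in at_right (h_unit h). dist (evolution_op h U t y) y < e"
    unfolding eventually_at_right_field
    using d close by (intro exI[of _ "h_unit h + min d 1"]) auto
qed

end

theorem lemma9:
  fixes h :: "real \<Rightarrow> real"
    and U :: "real \<Rightarrow> real \<Rightarrow> ('x::banach \<Rightarrow>\<^sub>L 'x)"
    and K \<alpha> :: real
  assumes "growth_rate h"
    and "h_evolution_family U"
    and "h_bounded h U K \<alpha>"
  shows "(\<forall>t\<ge>h_unit h. \<forall>u\<in>C0. evolution_fun h U t u \<in> C0) \<and>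
         h_semigroup h (evolution_op h U) \<and>
         h_strongly_continuous h (evolution_op h U)"
  using evolution_fun_in_C0[OF assms] h_semigroup_evolution_op[OF assms]
    h_strongly_continuous_evolution_op[OF assms] by blast

end
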